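(* Let $D$ be a proper open subset of $\mathbb{C}^n$. For $z\in D$ put $$I_{D,z}=\{X\in\mathbb{C}^n : z+\lambda X\in D \text{ for all } \lambda\in\mathbb{C} \text{ with } |\lambda|\le 1\},\qquad B_{D,z}=z+I_{D,z},$$ and let $$H_D=\{(z,w)\in D\times\mathbb{C}^n : w\in I_{D,z}\}\subset\mathbb{C}^{n}\times\mathbb{C}^n .$$ Then the following properties are equivalent: (1) $D$ is pseudoconvex; (2) $H_D$ is pseudoconvex; (3) $B_{D,z}$ is pseudoconvex for every $z\in D$.
   Context: A domain $B$ is called balanced, centered at $a$, if $a+\zeta(z-a)\in B$ for every $z\in B$ and every $\zeta\in\mathbb{C}$ with $|\zeta|\le 1$. The set $B_{D,z}$ is the largest balanced domain centered at $z$ and contained in $D$; $I_{D,z}$ is called the balanced indicatrix of $D$ at $z$. "Proper" means $D\ne\mathbb{C}^n$. Pseudoconvexity of an open set is understood in the usual sense of several complex variables. *)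

theory Defs
  imports "HOL-Analysis.Analysis"
begin

text \<open>
  Complex \<open>k\<close>-space is \<open>complex ^ 'k\<close>; complex scalar multiplication is \<open>*s\<close>
  (the operation \<open>*\<^sub>R\<close> is only the real one). Continuous plurisubharmonic functions are
  real-valued and are described by the sub-mean value inequality on every closed affine
  disc \<open>a + l b\<close>, \<open>|l| \<le> 1\<close>, contained in \<open>U\<close>. By continuity, the integral is that of a
  continuous function.
\<close>

definition continuous_psh_on :: "(complex ^ 'k) set \<Rightarrow> (complex ^ 'k \<Rightarrow> real) \<Rightarrow> bool" where
  "continuous_psh_on U u \<longleftrightarrow>
     continuous_on U u \<and>
     (\<forall>a b. (\<forall>l::complex. norm l \<le> 1 \<longrightarrow> a + l *s b \<in> U) \<longrightarrow>
        u a \<le> 1 / (2 * pi) * integral {0..2 * pi} (\<lambda>t. u (a + cis t *s b)))"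

text \<open>
  Pseudoconvexity is the existence of a continuous plurisubharmonic exhaustion function.
  Connectedness is not required, and the empty set is pseudoconvex.
\<close>

definition pseudoconvex :: "(complex ^ 'k) set \<Rightarrow> bool" where
  "pseudoconvex U \<longleftrightarrow>
     open U \<and>
     (\<exists>u. continuous_psh_on U u \<and> (\<forall>c. compact {z \<in> U. u z \<le> c}))"

definition balanced_indicatrix :: "(complex ^ 'n) set \<Rightarrow> complex ^ 'n \<Rightarrow> (complex ^ 'n) set" where
  "balanced_indicatrix D z = {X. \<forall>l::complex. norm l \<le> 1 \<longrightarrow> z + l *s X \<in> D}"

definition balanced_part :: "(complex ^ 'n) set \<Rightarrow> complex ^ 'n \<Rightarrow> (complex ^ 'n) set" where
  "balanced_part D z = (\<lambda>X. z + X) ` balanced_indicatrix D z"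

definition indicatrix_bundle :: "(complex ^ 'n) set \<Rightarrow> ((complex ^ 'n) \<times> (complex ^ 'n)) set" where
  "indicatrix_bundle D = {(z, w). z \<in> D \<and> w \<in> balanced_indicatrix D z}"

text \<open>
  The product type carries no complex scalar multiplication in the library, so the product of
  two copies of complex \<open>n\<close>-space is identified with \<open>complex ^ ('n + 'n)\<close> by concatenating
  coordinates.
\<close>

definition join_coords :: "(complex ^ 'n) \<times> (complex ^ 'n) \<Rightarrow> complex ^ ('n + 'n)" where
  "join_coords p = (\<chi> i. case i of Inl j \<Rightarrow> fst p $ j | Inr j \<Rightarrow> snd p $ j)"

end

theory Submission
  imports Defs "HOL-Computational_Algebra.Polynomial"
begin

text \<open>
  The three properties are shown to imply each other cyclically. Two of the implications are soft. If \<open>u\<close>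
  exhausts \<open>D\<close>, then the maximum of \<open>u (z + l w)\<close> over \<open>|l| \<le> 1\<close> exhausts the indicatrix bundle, and
  the balanced parts are slices of the bundle; both are instances of \<open>pseudoconvex_affine_family\<close>.

  The substance is that pseudoconvexity of all balanced parts makes \<open>- ln \<delta>\<close> plurisubharmonic on \<open>D\<close>, where
  \<open>\<delta>\<close> is the distance to the complement; then \<open>max (- ln \<delta>) norm\<close> exhausts \<open>D\<close>. Suppose that the
  sub-mean value inequality fails on a disc. A maximum argument (\<open>subharmonic_failure_touching\<close>) moves
  the failure to one point \<open>a\<close>: along a complex line \<open>a + l b\<close> and for small \<open>l\<close>, the radius \<open>\<delta>\<close> is at least
  \<open>\<delta> a |1 + c l + d l\<^sup>2| (1 + \<epsilon> |l|\<^sup>2)\<close> with \<open>\<epsilon> > 0\<close>. If \<open>a + X\<close> is a boundary point nearest to \<open>a\<close>, the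
  disc \<open>S l = a + l b + (1 + c l + d l\<^sup>2) X\<close> lies in \<open>D\<close> but for its centre \<open>S 0 = a + X\<close>.

  Now look at \<open>S\<close> from the point \<open>z = a + (1 - s) X\<close> of \<open>D\<close>, with \<open>s\<close> small. By
  \<open>centre_near_boundary_estimate\<close>, the points \<open>z + \<mu> (S l - z)\<close> with \<open>|\<mu>| \<le> 1\<close> and small \<open>|l|\<close> belong to \<open>D\<close>
  with the single exception \<open>\<mu> = 1\<close>, \<open>l = 0\<close>. Hence the balanced part of \<open>D\<close> at \<open>z\<close> contains the boundary of
  \<open>S\<close> and the discs \<open>z + t (S - z)\<close> for \<open>t < 1\<close>, but not the centre of \<open>S\<close>. In a pseudoconvex set this is
  impossible by the continuity principle (\<open>pseudoconvex_quadratic_discs\<close>).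

  The disc \<open>S\<close> is curved, while plurisubharmonicity here speaks about affine discs and merely continuous
  functions. The maximum principle on quadratic discs (\<open>psh_quadratic_disc_max\<close>) is therefore
  derived by doubling the variables, which avoids any regularization.
\<close>

section \<open>Means over circles\<close>

lemma norm_smult_complex [simp]: "norm (c *s (x :: complex ^ 'k)) = cmod c * norm x"
proof -
  have "norm (c *s x) = L2_set (\<lambda>i. cmod c * norm (x $ i)) UNIV"
    by (simp add: norm_vec_def norm_mult)
  also have "\<dots> = cmod c * norm x"
    by (simp add: norm_vec_def L2_set_right_distrib)
  finally show ?thesis .
qed

text \<open>
  Real-linear operations such as the inner product see a complex multiple through this formula.
\<close>

lemma smult_complex_expand:
  "c *s (x :: complex ^ 'k) = Re c *\<^sub>R x + Im c *\<^sub>R (\<i> *s x)"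
  by (simp add: vec_eq_iff complex_eq_iff)

lemma continuous_on_smult_complex [continuous_intros]:
  fixes g :: "'a::topological_space \<Rightarrow> complex ^ 'k"
  assumes "continuous_on S f" "continuous_on S g"
  shows "continuous_on S (\<lambda>x. f x *s g x)"
proof -
  have eq: "(\<lambda>x. f x *s g x) = (\<lambda>x. \<chi> i. f x * g x $ i)"
    by (simp add: fun_eq_iff vec_eq_iff)
  show ?thesis
    unfolding eq using assms by (intro continuous_intros)
qed

lemma has_integral_cis_power:
  assumes "k > 0"
  shows "((\<lambda>t. cis t ^ k) has_integral 0) {0..2*pi}"
proof -
  have "((\<lambda>t. cis (real k * t)) has_integral
      (\<lambda>t. - \<i> / of_nat k * cis (real k * t)) (2*pi) - (\<lambda>t. - \<i> / of_nat k * cis (real k * t)) 0) {0..2*pi}"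
  proof (rule fundamental_theorem_of_calculus)
    fix t :: real
    have "((\<lambda>z. - \<i> / of_nat k * exp (\<i> * of_nat k * z)) has_field_derivative
        exp (\<i> * of_nat k * of_real t)) (at (of_real t))"
      by (rule derivative_eq_intros refl | use assms in simp)+
    from has_vector_derivative_real_field[OF this, of "{0..2*pi}"]
    show "((\<lambda>t. - \<i> / of_nat k * cis (real k * t)) has_vector_derivative cis (real k * t))
        (at t within {0..2*pi})"
      by (simp add: cis_conv_exp mult.assoc)
  qed simp
  moreover have "cis (real k * (2*pi)) = 1"
    using cis_multiple_2pi[of "real k"] by (simp add: mult.commute)
  ultimately have "((\<lambda>t. cis (real k * t)) has_integral 0) {0..2*pi}"
    by simp
  then show ?thesis
    by (simp only: Complex.DeMoivre)
qed

lemma has_integral_smult_cis_power_inner: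
  fixes v w :: "complex ^ 'k"
  assumes "k > 0"
  shows "((\<lambda>t. v \<bullet> (cis t ^ k *s w)) has_integral 0) {0..2*pi}"
proof -
  note h = has_integral_cis_power[OF assms]
  have re: "((\<lambda>t. Re (cis t ^ k)) has_integral 0) {0..2*pi}"
    using has_integral_linear[OF h bounded_linear_Re] by (simp add: o_def)
  have im: "((\<lambda>t. Im (cis t ^ k)) has_integral 0) {0..2*pi}"
    using has_integral_linear[OF h bounded_linear_Im] by (simp add: o_def)
  have "((\<lambda>t. (v \<bullet> w) * Re (cis t ^ k) + (v \<bullet> (\<i> *s w)) * Im (cis t ^ k))
      has_integral (v \<bullet> w) * 0 + (v \<bullet> (\<i> *s w)) * 0) {0..2*pi}"
    by (intro has_integral_add has_integral_mult_right re im)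
  then show ?thesis
    by (subst smult_complex_expand) (simp add: inner_add_right mult.commute)
qed

lemma has_integral_Re_cis:
  "((\<lambda>t. Re (c * cis t)) has_integral 0) {0..2*pi}"
  using has_integral_linear[OF has_integral_mult_right[OF has_integral_cis_power[of 1], of c] bounded_linear_Re]
  by (simp add: o_def)

lemma has_integral_circle:
  fixes u :: "complex ^ 'k \<Rightarrow> real"
  assumes "continuous_on U u" and disc: "\<And>l. cmod l \<le> 1 \<Longrightarrow> a + l *s b \<in> U"
  shows "((\<lambda>t. u (a + cis t *s b)) has_integral integral {0..2*pi} (\<lambda>t. u (a + cis t *s b))) {0..2*pi}"
proof -
  have "continuous_on {0..2*pi} (\<lambda>t. u (a + cis t *s b))"
    by (rule continuous_on_compose2[OF assms(1)]) (use disc in \<open>auto intro!: continuous_intros\<close>)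
  then show ?thesis
    by (intro integrable_integral integrable_continuous_interval)
qed

lemma psh_le_circle_integral:
  assumes u: "continuous_psh_on U u"
    and disc: "\<And>l. cmod l \<le> 1 \<Longrightarrow> a + l *s b \<in> U"
    and le: "\<And>t. u (a + cis t *s b) \<le> f t"
    and f: "(f has_integral I) {0..2*pi}"
  shows "2 * pi * u a \<le> I"
proof -
  have "continuous_on U u" using u by (simp add: continuous_psh_on_def)
  from has_integral_le[OF has_integral_circle[OF this disc] f] le
  have "integral {0..2*pi} (\<lambda>t. u (a + cis t *s b)) \<le> I" by blast
  moreover have "u a \<le> 1 / (2 * pi) * integral {0..2 * pi} (\<lambda>t. u (a + cis t *s b))"
    using u disc unfolding continuous_psh_on_def by blast
  ultimately show ?thesis
    by (simp add: field_simps)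
qed

text \<open>
  In this form the criterion applies to suprema: on a given disc, the minorant is a
  member of the family that attains the supremum at the centre of the disc.
\<close>

lemma continuous_psh_onI:
  assumes cont: "continuous_on U u"
    and minorant: "\<And>a b. (\<And>l. cmod l \<le> 1 \<Longrightarrow> a + l *s b \<in> U) \<Longrightarrow>
      \<exists>f I. (f has_integral I) {0..2*pi} \<and> 2 * pi * u a \<le> I \<and> (\<forall>t. f t \<le> u (a + cis t *s b))"
  shows "continuous_psh_on U u"
  unfolding continuous_psh_on_def
proof (intro conjI allI impI)
  fix a b
  assume disc: "\<forall>l. norm l \<le> 1 \<longrightarrow> a + l *s b \<in> U"
  then obtain f I where f: "(f has_integral I) {0..2*pi}" "2 * pi * u a \<le> I"
      "\<And>t. f t \<le> u (a + cis t *s b)"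
    using minorant[of a b] by blast
  have "I \<le> integral {0..2*pi} (\<lambda>t. u (a + cis t *s b))"
    by (rule has_integral_le[OF f(1) has_integral_circle[OF cont]]) (use disc f(3) in auto)
  with f(2) show "u a \<le> 1 / (2 * pi) * integral {0..2 * pi} (\<lambda>t. u (a + cis t *s b))"
    by (simp add: field_simps)
qed (rule cont)

section \<open>Harmonic approximation and touching in one variable\<close>

text \<open>
  On the unit circle \<open>cnj z = 1 / z\<close>, so \<open>cnj p * q\<close> is a Laurent polynomial there; negative powers
  disappear because \<open>Re (c * cnj z ^ k) = Re (cnj c * z ^ k)\<close>. This is what makes the functions
  \<open>Re p\<close> on the circle an algebra, to which Stone--Weierstrass applies.
\<close>

lemma circle_Re_cnj_mult_poly:
  fixes p q :: "complex poly"
  shows "\<exists>r. \<forall>z. cmod z = 1 \<longrightarrow> Re (cnj (poly p z) * poly q z) = Re (poly r z)"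
proof (induction p arbitrary: q)
  case 0
  show ?case by (intro exI[of _ 0]) simp
next
  case (pCons a p)
  obtain b q' where q: "q = pCons b q'" by (cases q)
  obtain r where r: "\<And>z. cmod z = 1 \<Longrightarrow> Re (cnj (poly p z) * poly q' z) = Re (poly r z)"
    using pCons.IH by blast
  have "Re (cnj (poly (pCons a p) z) * poly q z)
      = Re (poly (smult (cnj a) q + r + smult (cnj b) (pCons 0 p)) z)" if z: "cmod z = 1" for z
  proof -
    have zz: "cnj z * z = 1"
      using z by (simp add: complex_norm_square[symmetric] mult.commute)
    have "cnj (poly (pCons a p) z) * poly q z
        = cnj a * poly q z + cnj (cnj b * (z * poly p z)) + (cnj z * z) * (cnj (poly p z) * poly q' z)"
      by (simp add: q algebra_simps)
    then have "Re (cnj (poly (pCons a p) z) * poly q z)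
        = Re (cnj a * poly q z) + Re (cnj b * (z * poly p z)) + Re (cnj (poly p z) * poly q' z)"
      unfolding zz by (simp only: plus_complex.sel complex_cnj mult_1 cnj.sel)
    then show ?thesis
      using r[OF z] by (simp only: poly_add poly_smult poly_pCons plus_complex.sel) simp
  qed
  then show ?case by blast
qed

lemma circle_Re_poly_mult_Re_poly:
  fixes p q :: "complex poly"
  shows "\<exists>r. \<forall>z. cmod z = 1 \<longrightarrow> Re (poly p z) * Re (poly q z) = Re (poly r z)"
proof -
  obtain r where r: "\<And>z. cmod z = 1 \<Longrightarrow> Re (cnj (poly p z) * poly q z) = Re (poly r z)"
    using circle_Re_cnj_mult_poly by blast
  have "Re (poly p z) * Re (poly q z) = Re (poly (smult (1/2) (p * q + r)) z)" if "cmod z = 1" for z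
    using r[OF that] by simp
  then show ?thesis by blast
qed

lemma real_polynomial_function_eq_Re_poly_on_circle:
  fixes g :: "complex \<Rightarrow> real"
  assumes "real_polynomial_function g"
  shows "\<exists>p. \<forall>z. cmod z = 1 \<longrightarrow> g z = Re (poly p z)"
  using assms
proof induction
  case (linear f)
  interpret bounded_linear f by fact
  have "f z = Re (poly [:0, Complex (f 1) (- f \<i>):] z)" for z
  proof -
    have "f z = f (Re z *\<^sub>R 1 + Im z *\<^sub>R \<i>)"
      by (rule arg_cong[of _ _ f]) (simp add: complex_eq_iff)
    then show ?thesis by (simp add: add scaleR)
  qed
  then show ?case by blast
next
  case (const c)
  show ?case by (intro exI[of _ "[:of_real c:]"]) simp
next
  case (add f g)
  then show ?case by (metis poly_add plus_complex.sel(1))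
next
  case (mult f g)
  then show ?case using circle_Re_poly_mult_Re_poly by metis
qed

text \<open>
  In place of the Poisson integral: boundary values on the circle are approximated by harmonic
  functions \<open>Re p\<close> whose mean value property is plain. Approximate solutions of the Dirichlet
  problem suffice, because only strict inequalities are transported into the disc.
\<close>

lemma circle_approx_Re_poly:
  fixes f :: "complex \<Rightarrow> real"
  assumes "continuous_on (sphere 0 1) f" "e > 0"
  obtains p where "\<And>z. cmod z = 1 \<Longrightarrow> \<bar>f z - Re (poly p z)\<bar> < e"
proof -
  obtain g where g: "real_polynomial_function g" "\<And>z. z \<in> sphere 0 1 \<Longrightarrow> \<bar>f z - g z\<bar> < e"
    using Stone_Weierstrass_real_polynomial_function[OF compact_sphere assms] by blast
  obtain p where "\<forall>z. cmod z = 1 \<longrightarrow> g z = Re (poly p z)"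
    using real_polynomial_function_eq_Re_poly_on_circle[OF g(1)] by blast
  with g(2) show ?thesis by (intro that) auto
qed

lemma has_integral_Re_poly_circle:
  "((\<lambda>t. Re (poly p (cis t))) has_integral 2 * pi * Re (poly p 0)) {0..2*pi}"
proof -
  obtain a q where p: "p = pCons a q" by (cases p)
  have "((\<lambda>t. \<Sum>i\<le>degree q. coeff q i * cis t ^ Suc i) has_integral (\<Sum>i\<le>degree q. coeff q i * 0)) {0..2*pi}"
    by (intro has_integral_sum has_integral_mult_right has_integral_cis_power) auto
  moreover have "(\<Sum>i\<le>degree q. coeff q i * z ^ Suc i) = z * poly q z" for z
    by (simp add: poly_altdef sum_distrib_left mult_ac)
  ultimately have "((\<lambda>t. cis t * poly q (cis t)) has_integral 0) {0..2*pi}"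
    by simp
  from has_integral_linear[OF this bounded_linear_Re]
  have "((\<lambda>t. Re (cis t * poly q (cis t))) has_integral 0) {0..2*pi}"
    by (simp add: o_def)
  then have "((\<lambda>t. Re a + Re (cis t * poly q (cis t))) has_integral (2 * pi * Re a + 0)) {0..2*pi}"
    using has_integral_const_real[of "Re a" 0 "2*pi"] by (intro has_integral_add) auto
  then show ?thesis by (simp add: p)
qed

text \<open>
  A failure of the sub-mean value inequality becomes local: where \<open>f - Re p + \<epsilon> |z|\<^sup>2\<close> is maximal,
  with \<open>p\<close> approximating \<open>f\<close> on the circle, the function \<open>f\<close> is touched from above by a strictly
  superharmonic function of the form \<open>Re q - \<epsilon> |z|\<^sup>2\<close> plus a constant.
\<close>

lemma subharmonic_failure_touching:
  fixes f :: "complex \<Rightarrow> real"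
  assumes cont: "continuous_on (cball 0 1) f"
    and fail: "1 / (2 * pi) * integral {0..2*pi} (\<lambda>t. f (cis t)) < f 0"
  obtains w q \<epsilon> where "cmod w < 1" "\<epsilon> > 0" "poly q 0 = 0"
    "\<And>z. cmod (w + z) \<le> 1 \<Longrightarrow> f (w + z) \<le> f w + Re (poly q z) - \<epsilon> * (cmod z)^2"
proof -
  \<comment> \<open>The gap is split into four parts: one for the approximation error on the circle, one for
    its effect on the centre value of the harmonic function, one for the perturbation, and one to spare.\<close>
  define \<epsilon> where "\<epsilon> = (f 0 - 1 / (2 * pi) * integral {0..2*pi} (\<lambda>t. f (cis t))) / 4"
  have eps: "\<epsilon> > 0" using fail by (simp add: \<epsilon>_def)
  have mean: "integral {0..2*pi} (\<lambda>t. f (cis t)) = 2 * pi * (f 0 - 4 * \<epsilon>)"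
  proof -
    have "4 * \<epsilon> = f 0 - 1 / (2 * pi) * integral {0..2*pi} (\<lambda>t. f (cis t))" by (simp add: \<epsilon>_def)
    then show ?thesis by simp
  qed
  obtain p where p: "\<And>z. cmod z = 1 \<Longrightarrow> \<bar>f z - Re (poly p z)\<bar> < \<epsilon>"
    using circle_approx_Re_poly[OF continuous_on_subset[OF cont] eps] by auto
  have p0: "Re (poly p 0) \<le> f 0 - 3 * \<epsilon>"
  proof -
    have "continuous_on {0..2*pi} (\<lambda>t. f (cis t))"
      by (rule continuous_on_compose2[OF cont]) (auto intro!: continuous_intros)
    then have "((\<lambda>t. f (cis t)) has_integral 2 * pi * (f 0 - 4 * \<epsilon>)) {0..2*pi}"
      using integrable_integral[OF integrable_continuous_interval] mean by metis
    from has_integral_add[OF this has_integral_const_real[of \<epsilon> 0 "2*pi"]]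
    have *: "((\<lambda>t. f (cis t) + \<epsilon>) has_integral 2 * pi * (f 0 - 4 * \<epsilon>) + 2 * pi * \<epsilon>) {0..2*pi}"
      by simp
    have "2 * pi * Re (poly p 0) \<le> 2 * pi * (f 0 - 4 * \<epsilon>) + 2 * pi * \<epsilon>"
    proof (rule has_integral_le[OF has_integral_Re_poly_circle *])
      fix t show "Re (poly p (cis t)) \<le> f (cis t) + \<epsilon>"
        using p[of "cis t"] by simp
    qed
    also have "\<dots> = 2 * pi * (f 0 - 3 * \<epsilon>)" by (simp add: algebra_simps)
    finally show ?thesis by simp
  qed
  define F where "F = (\<lambda>z. f z - Re (poly p z) + \<epsilon> * (cmod z)^2)"
  have "continuous_on (cball 0 1) F"
    unfolding F_def by (intro continuous_intros cont)
  then obtain w where w: "cmod w \<le> 1" "\<And>z. cmod z \<le> 1 \<Longrightarrow> F z \<le> F w"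
    using continuous_attains_sup[of "cball 0 1" F] by auto
  have "cmod w \<noteq> 1"
  proof
    assume "cmod w = 1"
    then have "F w < 2 * \<epsilon>" using p[of w] by (simp add: F_def)
    moreover have "F 0 \<ge> 3 * \<epsilon>" using p0 by (simp add: F_def)
    ultimately show False using w(2)[of 0] eps by simp
  qed
  with w(1) have w1: "cmod w < 1" by simp
  \<comment> \<open>Recentring \<open>|w + z|\<^sup>2\<close> at \<open>w\<close> leaves \<open>|z|\<^sup>2\<close> and a term that is the real part of a linear polynomial.\<close>
  define q where "q = pcompose p [:w, 1:] - [:poly p w:] - [:0, of_real (2 * \<epsilon>) * cnj w:]"
  have "f (w + z) \<le> f w + Re (poly q z) - \<epsilon> * (cmod z)^2" if "cmod (w + z) \<le> 1" for z
  proof -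
    have "(cmod (w + z))^2 = (cmod w)^2 + 2 * Re (cnj w * z) + (cmod z)^2"
      unfolding cmod_power2 by (simp add: power2_eq_square algebra_simps)
    then show ?thesis
      using w(2)[OF that] by (simp add: F_def q_def poly_pcompose algebra_simps)
  qed
  with w1 eps show ?thesis
    by (intro that[of w \<epsilon> q]) (auto simp: q_def poly_pcompose)
qed

lemma exp_poly_quadratic_jet:
  fixes q :: "complex poly"
  assumes "poly q 0 = 0"
  obtains c d C where "C \<ge> 0"
    "\<And>z. cmod z \<le> 1 \<Longrightarrow> cmod (exp (poly q z) - (1 + c * z + d * z^2)) \<le> C * cmod z ^ 3"
proof -
  \<comment> \<open>The \<open>i\<close>-th derivative of \<open>exp q\<close> is \<open>P i * exp q\<close>.\<close>
  define P where "P = rec_nat 1 (\<lambda>_ r. pderiv r + r * pderiv q)"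
  have P: "P 0 = 1" "\<And>i. P (Suc i) = pderiv (P i) + P i * pderiv q"
    by (simp_all add: P_def)
  define f where "f = (\<lambda>i z. poly (P i) z * exp (poly q z))"
  have df: "(f i has_field_derivative f (Suc i) z) (at z within S)" for i z S
    unfolding f_def
    by (rule derivative_eq_intros refl poly_DERIV[THEN DERIV_subset] | simp add: P algebra_simps)+
  have "continuous_on (cball 0 1) (f 3)"
    unfolding f_def by (intro continuous_intros)
  then have "bounded (f 3 ` cball 0 1)"
    by (intro compact_imp_bounded compact_continuous_image) auto
  then obtain B where B: "B > 0" "\<And>z. cmod z \<le> 1 \<Longrightarrow> cmod (f 3 z) \<le> B"
    unfolding bounded_pos by auto
  have "cmod (exp (poly q z) - (1 + f 1 0 * z + f 2 0 / 2 * z^2)) \<le> B / 2 * cmod z ^ 3" if "cmod z \<le> 1" for z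
  proof -
    have "cmod (f 0 z - (\<Sum>i\<le>2. f i 0 * (z - 0) ^ i / fact i)) \<le> B * cmod (z - 0) ^ Suc 2 / fact 2"
      by (rule complex_Taylor[of "cball 0 1" 2 f]) (use df B that in \<open>auto simp: numeral_3_eq_3\<close>)
    moreover have "f 0 z = exp (poly q z)" "f 0 0 = 1" using assms by (auto simp: f_def P)
    ultimately show ?thesis
      by (simp add: numeral_2_eq_2 numeral_3_eq_3)
  qed
  with B(1) show ?thesis by (intro that[of "B/2" "f 1 0" "f 2 0 / 2"]) auto
qed

text \<open>
  The cubic error of the Taylor expansion of \<open>exp q\<close> is absorbed by half of the quadratic gain.
  So only discs that are quadratic in the parameter have to be considered.
\<close>

lemma quadratic_jet_lower_bound:
  fixes q :: "complex poly"
  assumes "poly q 0 = 0" and eps: "\<epsilon> > 0"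
  obtains c d \<rho> where "\<rho> > 0"
    "\<And>z. cmod z \<le> \<rho> \<Longrightarrow> cmod (1 + c * z + d * z^2) * (1 + \<epsilon> / 2 * (cmod z)^2)
      \<le> cmod (exp (poly q z)) * exp (\<epsilon> * (cmod z)^2)"
proof -
  obtain c d C where C: "C \<ge> 0"
    and jet: "\<And>z. cmod z \<le> 1 \<Longrightarrow> cmod (exp (poly q z) - (1 + c * z + d * z^2)) \<le> C * cmod z ^ 3"
    using exp_poly_quadratic_jet[OF assms(1)] by metis
  define \<rho> where "\<rho> = Min {1, 1 / (2 * (cmod c + cmod d + 1)), \<epsilon> / (4 * (C * (1 + \<epsilon>) + 1))}"
  have p1: "cmod c + cmod d + 1 > 0" and p2: "C * (1 + \<epsilon>) + 1 > 0"
    using C eps by (auto intro!: add_nonneg_pos)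
  have rho: "\<rho> > 0" "\<rho> \<le> 1" "\<rho> \<le> 1 / (2 * (cmod c + cmod d + 1))"
      "\<rho> \<le> \<epsilon> / (4 * (C * (1 + \<epsilon>) + 1))"
    using p1 p2 eps by (auto simp: \<rho>_def)
  have "cmod (1 + c * z + d * z^2) * (1 + \<epsilon> / 2 * (cmod z)^2)
      \<le> cmod (exp (poly q z)) * exp (\<epsilon> * (cmod z)^2)" if z: "cmod z \<le> \<rho>" for z
  proof -
    define x where "x = cmod z"
    define g where "g = 1 + c * z + d * z^2"
    have x: "0 \<le> x" "x \<le> \<rho>" "x \<le> 1" using z rho by (auto simp: x_def)
    have x2: "x^2 \<le> x" using x by (simp add: power2_eq_square mult_left_le_one_le)
    have "x * (cmod c + cmod d) \<le> \<rho> * (cmod c + cmod d + 1)"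
      using x by (intro mult_mono) auto
    also have "\<dots> \<le> 1 / 2" using rho(3) p1 by (simp add: field_simps)
    finally have cd: "x * (cmod c + cmod d) \<le> 1 / 2" .
    have "x * (C * (1 + \<epsilon>)) \<le> \<rho> * (C * (1 + \<epsilon>) + 1)"
      using x C eps by (intro mult_mono) auto
    also have "\<dots> \<le> \<epsilon> / 4" using rho(4) p2 by (simp add: field_simps)
    finally have Ce: "x * (C * (1 + \<epsilon>)) \<le> \<epsilon> / 4" .
    have "cmod (g - 1) \<le> cmod c * x + cmod d * x^2"
      using norm_triangle_ineq[of "c * z" "d * z^2"] by (simp add: g_def x_def norm_mult norm_power)
    also have "\<dots> \<le> cmod c * x + cmod d * x" using x2 by (intro add_left_mono mult_left_mono) auto
    also have "\<dots> \<le> 1 / 2" using cd by (simp add: algebra_simps)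
    finally have g: "cmod g \<ge> 1 / 2"
      using norm_triangle_ineq2[of 1 "1 - g"] by (simp add: norm_minus_commute)
    have E: "cmod (exp (poly q z)) \<ge> cmod g - C * x^3"
      using jet[of z] x norm_triangle_ineq2[of g "exp (poly q z)"]
      by (simp add: x_def g_def norm_minus_commute)
    have "C * x^3 * (1 + \<epsilon> * x^2) \<le> C * x^3 * (1 + \<epsilon> * 1)"
      using x C eps by (intro mult_left_mono add_left_mono) (auto simp: power_le_one)
    also have "\<dots> = x^2 * (x * (C * (1 + \<epsilon>)))" by (simp add: power2_eq_square power3_eq_cube)
    also have "\<dots> \<le> x^2 * (\<epsilon> / 4)" using Ce by (intro mult_left_mono) auto
    also have "\<dots> = (1/2) * (\<epsilon> / 2 * x^2)" by simp
    also have "\<dots> \<le> cmod g * (\<epsilon> / 2 * x^2)" using g eps by (intro mult_right_mono) auto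
    finally have "cmod g * (1 + \<epsilon> / 2 * x^2) \<le> (cmod g - C * x^3) * (1 + \<epsilon> * x^2)"
      by (simp add: algebra_simps)
    also have "\<dots> \<le> cmod (exp (poly q z)) * (1 + \<epsilon> * x^2)"
      using E eps by (intro mult_right_mono) auto
    also have "\<dots> \<le> cmod (exp (poly q z)) * exp (\<epsilon> * x^2)"
      by (intro mult_left_mono exp_ge_add_one_self) auto
    finally show ?thesis by (simp add: g_def x_def)
  qed
  with rho(1) show ?thesis by (rule that)
qed

section \<open>Stability of pseudoconvexity under affine families\<close>

text \<open>
  If \<open>u\<close> exhausts \<open>D\<close>, then \<open>x \<mapsto> max {u (L l x) | |l| \<le> 1}\<close> exhausts the set of all \<open>x\<close> that every
  \<open>L l\<close> sends into \<open>D\<close>. The linear part \<open>M\<close> of \<open>L\<close> carries discs to discs, and properness turns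
  compact sublevel sets of \<open>u\<close> into bounded ones. A family that does not depend on \<open>l\<close> covers
  preimages under a single affine embedding.
\<close>

lemma pseudoconvex_affine_family:
  fixes D :: "(complex ^ 'n) set" and L :: "complex \<Rightarrow> complex ^ 'm \<Rightarrow> complex ^ 'n"
  assumes D: "pseudoconvex D"
    and cont: "continuous_on UNIV (\<lambda>(x, l). L l x)"
    and affine: "\<And>l a b c. L l (a + c *s b) = L l a + c *s M l b"
    and proper: "\<And>B. bounded {x. \<forall>l. cmod l \<le> 1 \<longrightarrow> norm (L l x) \<le> B}"
  shows "pseudoconvex {x. \<forall>l. cmod l \<le> 1 \<longrightarrow> L l x \<in> D}" (is "pseudoconvex ?U")
proof -
  obtain u where "open D" and u: "continuous_psh_on D u" and exh: "\<And>c. compact {z \<in> D. u z \<le> c}"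
    using D unfolding pseudoconvex_def by blast
  have uc: "continuous_on D u" using u by (simp add: continuous_psh_on_def)
  have cont_x: "continuous_on S (L l)" for l S
  proof -
    have "continuous_on S (\<lambda>x. case (x, l) of (x, l) \<Rightarrow> L l x)"
      by (rule continuous_on_compose2[OF cont]) (auto intro!: continuous_intros)
    then show ?thesis by simp
  qed
  have cont_l: "continuous_on S (\<lambda>l. L l x)" for x S
  proof -
    have "continuous_on S (\<lambda>l. case (x, l) of (x, l) \<Rightarrow> L l x)"
      by (rule continuous_on_compose2[OF cont]) (auto intro!: continuous_intros)
    then show ?thesis by simp
  qed
  have "open ?U"
  unfolding open_subopen[of ?U]
  proof (intro ballI)
    fix x assume "x \<in> ?U"
    then have sub: "{x} \<times> cball 0 1 \<subseteq> (\<lambda>(x, l). L l x) -` D" by auto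
    have op: "open ((\<lambda>(x, l). L l x) -` D)"
      by (rule open_vimage[OF \<open>open D\<close> cont])
    obtain X where "x \<in> X" "open X" "X \<times> cball 0 1 \<subseteq> (\<lambda>(x, l). L l x) -` D"
      using Elementary_Topology.tube_lemma[OF compact_cball op sub] by blast
    then show "\<exists>T. open T \<and> x \<in> T \<and> T \<subseteq> ?U" by (intro exI[of _ X]) force
  qed
  have "\<forall>x\<in>?U. \<exists>l. cmod l \<le> 1 \<and> (\<forall>k. cmod k \<le> 1 \<longrightarrow> u (L k x) \<le> u (L l x))"
  proof
    fix x assume x: "x \<in> ?U"
    have "continuous_on (cball 0 1) (\<lambda>l. u (L l x))"
      by (rule continuous_on_compose2[OF uc cont_l]) (use x in auto)
    then show "\<exists>l. cmod l \<le> 1 \<and> (\<forall>k. cmod k \<le> 1 \<longrightarrow> u (L k x) \<le> u (L l x))"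
      using continuous_attains_sup[of "cball 0 1" "\<lambda>l. u (L l x)"] by auto
  qed
  from bchoice[OF this] obtain l0 where
      l0: "\<forall>x\<in>?U. cmod (l0 x) \<le> 1 \<and> (\<forall>k. cmod k \<le> 1 \<longrightarrow> u (L k x) \<le> u (L (l0 x) x))" ..
  define V where "V = (\<lambda>x. u (L (l0 x) x))"
  have V: "cmod (l0 x) \<le> 1 \<and> V x = u (L (l0 x) x)" if "x \<in> ?U" for x
    using bspec[OF l0 that] by (simp add: V_def)
  have Vmax: "u (L k x) \<le> V x" if "x \<in> ?U" "cmod k \<le> 1" for x k
    using bspec[OF l0 that(1)] that(2) by (simp add: V_def)
  have Vcont: "continuous_on ?U V"
    unfolding continuous_on_def tendsto_iff eventually_at_topological
  proof (intro ballI allI impI)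
    fix x e assume x: "x \<in> ?U" and e: "(0::real) < e"
    have fc: "continuous_on (?U \<times> cball 0 1) (\<lambda>p. u (case p of (x, l) \<Rightarrow> L l x))"
      by (rule continuous_on_compose2[OF uc continuous_on_subset[OF cont]]) auto
    have e2: "e / 2 > 0" using e by simp
    obtain X where X: "x \<in> X" "open X"
      "\<forall>y \<in> X \<inter> ?U. \<forall>l \<in> cball 0 1. dist (u (L l y)) (u (L l x)) \<le> e / 2"
      by (rule continuous_on_prod_compactE[OF fc compact_cball x e2]) auto
    have "dist (V y) (V x) < e" if y: "y \<in> X" "y \<in> ?U" for y
    proof -
      have "u (L l y) \<le> u (L l x) + e / 2 \<and> u (L l x) \<le> u (L l y) + e / 2" if "cmod l \<le> 1" for l
      proof -
        have "dist (u (L l y)) (u (L l x)) \<le> e / 2" using X(3) y that by simp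
        then show ?thesis unfolding dist_real_def by linarith
      qed
      from this[of "l0 x"] this[of "l0 y"] show ?thesis
        using V[OF y(2)] V[OF x] Vmax[OF y(2), of "l0 x"] Vmax[OF x, of "l0 y"] e
        unfolding dist_real_def by linarith
    qed
    with X(1,2) show "\<exists>S. open S \<and> x \<in> S \<and> (\<forall>y\<in>S. y \<noteq> x \<longrightarrow> y \<in> ?U \<longrightarrow> dist (V y) (V x) < e)"
      by blast
  qed
  have "continuous_psh_on ?U V"
  proof (rule continuous_psh_onI[OF Vcont])
    fix a b assume disc: "\<And>c. cmod c \<le> 1 \<Longrightarrow> a + c *s b \<in> ?U"
    then have a: "a \<in> ?U" using disc[of 0] by simp
    let ?k = "l0 a"
    let ?f = "\<lambda>t. u (L ?k a + cis t *s M ?k b)"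
    have k: "cmod ?k \<le> 1" "V a = u (L ?k a)" using V[OF a] by auto
    have mem: "L ?k a + c *s M ?k b \<in> D" if "cmod c \<le> 1" for c
      using disc[OF that] k(1) by (auto simp: affine)
    have int: "(?f has_integral integral {0..2*pi} ?f) {0..2*pi}"
      by (rule has_integral_circle[OF uc mem])
    have "2 * pi * V a \<le> integral {0..2*pi} ?f"
      unfolding k(2) by (rule psh_le_circle_integral[OF u mem _ int]) auto
    moreover have "?f t \<le> V (a + cis t *s b)" for t
      using Vmax[OF disc[of "cis t"] k(1)] by (simp add: affine)
    ultimately show "\<exists>f I. (f has_integral I) {0..2*pi} \<and> 2 * pi * V a \<le> I \<and> (\<forall>t. f t \<le> V (a + cis t *s b))"
      using int by blast
  qed
  moreover have "compact {x \<in> ?U. V x \<le> c}" for c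
  proof -
    let ?K = "{z \<in> D. u z \<le> c}"
    have eq: "{x \<in> ?U. V x \<le> c} = (\<Inter>l\<in>cball 0 1. L l -` ?K)"
    proof (intro equalityI subsetI)
      fix x assume "x \<in> {x \<in> ?U. V x \<le> c}"
      then show "x \<in> (\<Inter>l\<in>cball 0 1. L l -` ?K)"
        using Vmax[of x] by force
    next
      fix x assume x: "x \<in> (\<Inter>l\<in>cball 0 1. L l -` ?K)"
      then have "x \<in> ?U" by auto
      with x V[of x] show "x \<in> {x \<in> ?U. V x \<le> c}" by auto
    qed
    have "closed (\<Inter>l\<in>cball 0 1. L l -` ?K)"
      by (intro closed_INT ballI closed_vimage compact_imp_closed[OF exh] cont_x)
    moreover obtain B where "\<And>z. z \<in> ?K \<Longrightarrow> norm z \<le> B"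
      using compact_imp_bounded[OF exh[of c]] unfolding bounded_iff by blast
    then have "(\<Inter>l\<in>cball 0 1. L l -` ?K) \<subseteq> {x. \<forall>l. cmod l \<le> 1 \<longrightarrow> norm (L l x) \<le> B}"
      by auto
    ultimately show ?thesis
      unfolding eq compact_eq_bounded_closed using bounded_subset[OF proper] by blast
  qed
  ultimately show ?thesis
    using \<open>open ?U\<close> unfolding pseudoconvex_def by blast
qed

section \<open>The continuity principle for quadratic discs\<close>

text \<open>
  Plurisubharmonicity is a condition on affine discs, whereas \<open>P\<close> is curved, and a merely
  continuous \<open>u\<close> cannot be differentiated along \<open>P\<close>. Doubling of variables bridges the gap: if the
  bound failed, the function
  \<open>W (l, y) = u (P l + y) + \<epsilon> |l|\<^sup>2 - N |y|\<^sup>2\<close> would, for large \<open>N\<close>, have an interior maximum.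
  Follow the affine disc through the maximum point \<open>P l + y\<close> in the direction \<open>b = P' l\<close> while \<open>l\<close>
  moves to \<open>l + h\<close>. The offset becomes \<open>y - h\<^sup>2 C\<close>, whose squared norm has circle mean
  \<open>|y|\<^sup>2 + |h|\<^sup>4 |C|\<^sup>2\<close>: there is no term of order \<open>|h|\<^sup>2\<close>, so the gain \<open>\<epsilon> |h|\<^sup>2\<close> wins
  and contradicts maximality.
\<close>

lemma psh_quadratic_disc_max:
  fixes A B C :: "complex ^ 'k"
  defines "P \<equiv> \<lambda>l::complex. A + l *s B + l^2 *s C"
  assumes "open U" and u: "continuous_psh_on U u" and r: "r > 0"
    and disc: "\<And>l. cmod l \<le> r \<Longrightarrow> P l \<in> U"
    and bd: "\<And>l. cmod l = r \<Longrightarrow> u (P l) \<le> M"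
  shows "u A \<le> M"
proof (rule ccontr)
  assume "\<not> u A \<le> M"
  define g where "g = (u A - M) / 3"
  have g: "g > 0" using \<open>\<not> u A \<le> M\<close> by (simp add: g_def)
  define \<epsilon> where "\<epsilon> = g / r^2"
  have eps: "\<epsilon> > 0" "\<epsilon> * r^2 = g" using g r by (auto simp: \<epsilon>_def)
  have uc: "continuous_on U u" using u by (simp add: continuous_psh_on_def)
  have Pc: "continuous_on S P" for S unfolding P_def by (intro continuous_intros)
  have "compact (P ` cball 0 r)" by (intro compact_continuous_image Pc) auto
  moreover have "P ` cball 0 r \<subseteq> U" using disc by auto
  ultimately obtain \<eta>0 where eta0: "\<eta>0 > 0" "(\<Union>x\<in>P ` cball 0 r. cball x \<eta>0) \<subseteq> U"
    using compact_subset_open_imp_cball_epsilon_subset[OF _ \<open>open U\<close>] by metis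
  let ?Q = "cball (0 :: complex) r \<times> cball (0 :: complex ^ 'k) \<eta>0"
  have PU: "P l + y \<in> U" if "cmod l \<le> r" "norm y \<le> \<eta>0" for l y
    using eta0(2) that by (force simp: dist_norm)
  define F where "F = (\<lambda>(l, y). u (P l + y))"
  have Fc: "continuous_on ?Q F"
    unfolding F_def split_beta
    by (rule continuous_on_compose2[OF uc])
       (use PU in \<open>auto intro!: continuous_intros continuous_on_compose2[OF Pc]\<close>)
  have Qc: "compact ?Q" by (intro compact_Times compact_cball)
  have "uniformly_continuous_on ?Q F" using compact_uniformly_continuous[OF Fc Qc] .
  then obtain \<eta>1 where eta1: "\<eta>1 > 0"
      "\<And>p p'. p \<in> ?Q \<Longrightarrow> p' \<in> ?Q \<Longrightarrow> dist p' p < \<eta>1 \<Longrightarrow> dist (F p') (F p) < g"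
    using g unfolding uniformly_continuous_on_def by metis
  define \<eta> where "\<eta> = min \<eta>0 \<eta>1"
  have eta: "\<eta> > 0" "\<eta> \<le> \<eta>0" using eta0 eta1 by (auto simp: \<eta>_def)
  have close: "F (l, y) < F (l, 0) + g" if "cmod l \<le> r" "norm y < \<eta>" for l y
    using eta1(2)[of "(l, 0)" "(l, y)"] that eta0 by (auto simp: \<eta>_def dist_Pair_Pair dist_real_def)
  have "bounded (F ` ?Q)"
    by (intro compact_imp_bounded compact_continuous_image Fc Qc)
  then obtain Bd where Bd: "\<And>p. p \<in> ?Q \<Longrightarrow> \<bar>F p\<bar> \<le> Bd" unfolding bounded_iff by auto
  have Bd0: "Bd \<ge> 0" using Bd[of "(0, 0)"] r eta0 by auto
  \<comment> \<open>The penalty is so large that a maximum point of \<open>W\<close> has \<open>|y| < \<eta>\<close>.\<close>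
  define N where "N = (2 * Bd + g + 1) / \<eta>^2"
  have N: "N > 0" "N * \<eta>^2 = 2 * Bd + g + 1" using eta Bd0 g by (auto simp: N_def)
  define W where "W = (\<lambda>(l, y). F (l, y) + \<epsilon> * (cmod l)^2 - N * (norm y)^2)"
  have "continuous_on ?Q W"
    using Fc unfolding W_def split_beta by (intro continuous_intros) simp
  then obtain l y where ly: "cmod l \<le> r" "norm y \<le> \<eta>0"
      and Wmax: "\<And>l' y'. cmod l' \<le> r \<Longrightarrow> norm y' \<le> \<eta>0 \<Longrightarrow> W (l', y') \<le> W (l, y)"
    using continuous_attains_sup[OF Qc, of W] r eta0 by (auto simp: Ball_def)
  have W0: "u A \<le> W (l, y)"
    using Wmax[of 0 0] r eta0 by (simp add: W_def F_def P_def)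
  have el: "\<epsilon> * (cmod l)^2 \<le> g"
    unfolding eps(2)[symmetric] using ly eps by (intro mult_left_mono power_mono) auto
  have ny: "norm y < \<eta>"
  proof -
    have "F (0, 0) = u A" by (simp add: F_def P_def)
    then have "N * (norm y)^2 \<le> 2 * Bd + g"
      using W0 el Bd[of "(l, y)"] Bd[of "(0, 0)"] ly r eta0 by (auto simp: W_def)
    then have "N * (norm y)^2 < N * \<eta>^2" using N by simp
    then have "(norm y)^2 < \<eta>^2" using N(1) by simp
    then show ?thesis by (rule power2_less_imp_less) (use eta in auto)
  qed
  have lr: "cmod l < r"
  proof (rule ccontr)
    assume "\<not> cmod l < r"
    then have "cmod l = r" using ly by simp
    then have "F (l, 0) \<le> M" using bd by (simp add: F_def)
    with close[OF ly(1) ny] el have "W (l, y) < M + 2 * g"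
      using N(1) zero_le_power2[of "norm y"] by (smt (verit) W_def case_prod_conv mult_nonneg_nonneg)
    then show False using W0 g by (simp add: g_def field_simps)
  qed
  \<comment> \<open>Radius of the affine disc: the second and third entries keep it in the domain of \<open>W\<close>, and the
    last one makes \<open>N \<tau>\<^sup>4 |C|\<^sup>2\<close> smaller than \<open>\<epsilon> \<tau>\<^sup>2\<close>.\<close>
  define \<tau> where "\<tau> = Min {1, r - cmod l, (\<eta> - norm y) / (norm C + 1), \<epsilon> / (2 * (N * (norm C)^2 + 1))}"
  have tau: "\<tau> > 0" "\<tau> \<le> 1" "\<tau> \<le> r - cmod l" "\<tau> \<le> (\<eta> - norm y) / (norm C + 1)"
      "\<tau> \<le> \<epsilon> / (2 * (N * (norm C)^2 + 1))"
    using lr ny eps N by (auto simp: \<tau>_def add_nonneg_pos)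
  have tt: "\<tau>^2 \<le> \<tau>" using tau by (simp add: power2_eq_square mult_left_le_one_le)
  have tC: "\<tau>^2 * norm C \<le> \<eta> - norm y"
  proof -
    have "\<tau>^2 * norm C \<le> \<tau> * (norm C + 1)" using tt tau by (intro mult_mono) auto
    also have "\<dots> \<le> \<eta> - norm y"
      using tau(4) by (simp add: pos_le_divide_eq add_nonneg_pos)
    finally show ?thesis .
  qed
  have tN: "N * \<tau>^2 * (norm C)^2 < \<epsilon>"
  proof -
    have pos: "N * (norm C)^2 + 1 > 0" using N by (simp add: add_nonneg_pos)
    have "N * \<tau>^2 * (norm C)^2 = \<tau>^2 * (N * (norm C)^2)" by simp
    also have "\<dots> \<le> \<tau> * (N * (norm C)^2 + 1)" using tt tau N by (intro mult_mono) auto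
    also have "\<dots> \<le> \<epsilon> / 2"
      using tau(5) pos by (simp add: field_simps)
    finally show ?thesis using eps by simp
  qed
  define b where "b = B + (2 * l) *s C"
  have shift: "(P l + y) + h *s b = P (l + h) + (y - h^2 *s C)" for h
    by (simp add: P_def b_def vec_eq_iff power2_eq_square algebra_simps)
  have near: "cmod (l + h) \<le> r" "norm (y - h^2 *s C) \<le> \<eta>0" if "cmod h \<le> \<tau>" for h
  proof -
    show "cmod (l + h) \<le> r" using that tau(3) norm_triangle_ineq[of l h] by linarith
    have "norm (y - h^2 *s C) \<le> norm y + (cmod h)^2 * norm C"
      using norm_triangle_ineq4[of y "h^2 *s C"] by (simp add: norm_power)
    also have "\<dots> \<le> norm y + \<tau>^2 * norm C"
      using that by (intro add_left_mono mult_right_mono power_mono) auto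
    also have "\<dots> \<le> \<eta>0" using tC eta by linarith
    finally show "norm (y - h^2 *s C) \<le> \<eta>0" .
  qed
  have le: "u ((P l + y) + cis t *s (\<tau> *\<^sub>R b)) \<le> (u (P l + y) - \<epsilon> * \<tau>^2 + N * \<tau>^4 * (norm C)^2)
      + (- 2 * \<epsilon> * \<tau>) * Re (cnj l * cis t) + (- 2 * N * \<tau>^2) * (y \<bullet> (cis t ^ 2 *s C))" for t
  proof -
    define h where "h = \<tau> * cis t"
    have h: "cmod h = \<tau>" using tau by (simp add: h_def norm_mult)
    have "W (l + h, y - h^2 *s C) \<le> W (l, y)" using near[of h] h by (intro Wmax) auto
    then have "u ((P l + y) + h *s b) \<le> u (P l + y) + \<epsilon> * ((cmod l)^2 - (cmod (l + h))^2)
        + N * ((norm (y - h^2 *s C))^2 - (norm y)^2)"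
      unfolding shift by (simp add: W_def F_def algebra_simps)
    moreover have "(cmod (l + h))^2 = (cmod l)^2 + 2 * \<tau> * Re (cnj l * cis t) + \<tau>^2"
    proof -
      have "(cmod (l + h))^2 = (cmod l)^2 + 2 * Re (cnj l * h) + (cmod h)^2"
        unfolding cmod_power2 by (simp add: power2_eq_square algebra_simps)
      then show ?thesis unfolding h by (simp add: h_def algebra_simps)
    qed
    moreover have "(norm (y - h^2 *s C))^2 = (norm y)^2 - 2 * \<tau>^2 * (y \<bullet> (cis t ^ 2 *s C)) + \<tau>^4 * (norm C)^2"
    proof -
      have "h^2 *s C = \<tau>^2 *\<^sub>R (cis t ^ 2 *s C)"
        by (simp add: h_def vec_eq_iff power_mult_distrib scaleR_conv_of_real[where 'a = complex] mult_ac)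
      moreover have "(norm (h^2 *s C))^2 = \<tau>^4 * (norm C)^2"
        using h by (simp add: norm_power power_mult_distrib)
      moreover have "(norm (y - w))^2 = (norm y)^2 - 2 * (y \<bullet> w) + (norm w)^2" for w
        by (simp add: power2_norm_eq_inner inner_diff_left inner_diff_right inner_commute)
      ultimately show ?thesis by simp
    qed
    moreover have "h *s b = cis t *s (\<tau> *\<^sub>R b)"
      by (simp add: h_def vec_eq_iff scaleR_conv_of_real[where 'a = complex] mult_ac)
    ultimately show ?thesis
      by (simp add: algebra_simps)
  qed
  have "2 * pi * u (P l + y) \<le> 2 * pi * (u (P l + y) - \<epsilon> * \<tau>^2 + N * \<tau>^4 * (norm C)^2)
      + (- 2 * \<epsilon> * \<tau>) * 0 + (- 2 * N * \<tau>^2) * 0"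
  proof (rule psh_le_circle_integral[OF u _ le])
    fix h :: complex assume h: "cmod h \<le> 1"
    have "h *s (\<tau> *\<^sub>R b) = (h * \<tau>) *s b" by (simp add: vec_eq_iff scaleR_conv_of_real[where 'a = complex] mult_ac)
    moreover have "cmod (h * \<tau>) \<le> \<tau>" using h tau by (simp add: norm_mult mult_left_le_one_le)
    ultimately show "P l + y + h *s (\<tau> *\<^sub>R b) \<in> U"
      using near PU by (simp add: shift)
  next
    have "((\<lambda>t. y \<bullet> (cis t ^ 2 *s C)) has_integral 0) {0..2*pi}"
      by (rule has_integral_smult_cis_power_inner) simp
    moreover have "((\<lambda>t. k) has_integral 2 * pi * k) {0..2*pi}" for k :: real
      using has_integral_const_real[of k 0 "2*pi"] by simp
    ultimately show "((\<lambda>t. (u (P l + y) - \<epsilon> * \<tau>^2 + N * \<tau>^4 * (norm C)^2)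
      + (- 2 * \<epsilon> * \<tau>) * Re (cnj l * cis t) + (- 2 * N * \<tau>^2) * (y \<bullet> (cis t ^ 2 *s C))) has_integral
      2 * pi * (u (P l + y) - \<epsilon> * \<tau>^2 + N * \<tau>^4 * (norm C)^2)
      + (- 2 * \<epsilon> * \<tau>) * 0 + (- 2 * N * \<tau>^2) * 0) {0..2*pi}"
      by (intro has_integral_add has_integral_mult_right has_integral_Re_cis)
  qed
  then have "\<epsilon> * \<tau>^2 \<le> N * \<tau>^4 * (norm C)^2" by simp
  also have "\<dots> = (N * \<tau>^2 * (norm C)^2) * \<tau>^2" by (simp add: power2_eq_square power4_eq_xxxx)
  also have "\<dots> < \<epsilon> * \<tau>^2" using tN tau by (intro mult_strict_right_mono) auto
  finally show False by simp
qed

text \<open>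
  A continuity principle: the shrunken discs \<open>z + t P\<close>, \<open>t < 1\<close>, have their boundaries in one
  compact subset of \<open>U\<close>, so the maximum principle keeps their centres in a compact sublevel set of
  the exhaustion function. The limit of the centres therefore still lies in \<open>U\<close>.
\<close>

lemma pseudoconvex_quadratic_discs:
  fixes A B C z :: "complex ^ 'k"
  defines "P \<equiv> \<lambda>l::complex. A + l *s B + l^2 *s C"
  assumes U: "pseudoconvex U" and r: "r > 0"
    and disc: "\<And>t l. 0 \<le> t \<Longrightarrow> t < 1 \<Longrightarrow> cmod l \<le> r \<Longrightarrow> z + t *\<^sub>R P l \<in> U"
    and bd: "\<And>l. cmod l = r \<Longrightarrow> z + P l \<in> U"
  shows "z + A \<in> U"
proof -
  obtain u where "open U" and u: "continuous_psh_on U u" and exh: "\<And>c. compact {x \<in> U. u x \<le> c}"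
    using U unfolding pseudoconvex_def by blast
  have uc: "continuous_on U u" using u by (simp add: continuous_psh_on_def)
  let ?K = "{0..1::real} \<times> sphere (0::complex) r"
  have "continuous_on ?K (\<lambda>(t, l). u (z + t *\<^sub>R P l))"
    unfolding split_beta
  proof (rule continuous_on_compose2[OF uc])
    show "(\<lambda>x. z + fst x *\<^sub>R P (snd x)) ` ?K \<subseteq> U"
      using disc bd by (force simp: le_less)
  qed (auto simp: P_def intro!: continuous_intros)
  then have "bounded ((\<lambda>(t, l). u (z + t *\<^sub>R P l)) ` ?K)"
    by (intro compact_imp_bounded compact_continuous_image compact_Times) auto
  then obtain M where M: "\<And>t l. 0 \<le> t \<Longrightarrow> t \<le> 1 \<Longrightarrow> cmod l = r \<Longrightarrow> u (z + t *\<^sub>R P l) \<le> M"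
    unfolding bounded_iff by (fastforce simp: abs_le_iff)
  have in_K: "z + t *\<^sub>R A \<in> {x \<in> U. u x \<le> M}" if t: "0 \<le> t" "t < 1" for t
  proof -
    have eq: "(z + t *\<^sub>R A) + l *s (t *\<^sub>R B) + l^2 *s (t *\<^sub>R C) = z + t *\<^sub>R P l" for l
      by (simp add: P_def vec_eq_iff algebra_simps)
    have "u (z + t *\<^sub>R A) \<le> M"
      by (rule psh_quadratic_disc_max[OF \<open>open U\<close> u r, of "z + t *\<^sub>R A" "t *\<^sub>R B" "t *\<^sub>R C"])
         (use disc M t in \<open>auto simp: eq\<close>)
    then show ?thesis using disc[OF t, of 0] r by (simp add: P_def)
  qed
  have lim: "((\<lambda>t. z + t *\<^sub>R A) \<longlongrightarrow> z + 1 *\<^sub>R A) (at_left 1)"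
    by (intro tendsto_intros)
  have ev: "\<forall>\<^sub>F t in at_left 1. z + t *\<^sub>R A \<in> {x \<in> U. u x \<le> M}"
    by (rule eventually_mono[OF eventually_at_left_real[of 0 1]]) (use in_K in auto)
  have "z + 1 *\<^sub>R A \<in> {x \<in> U. u x \<le> M}"
    by (rule Lim_in_closed_set[OF compact_imp_closed[OF exh] ev _ lim]) simp
  then show ?thesis by simp
qed

section \<open>Discs seen from a point near the boundary\<close>

text \<open>
  Write \<open>g \<zeta> = 1 + c \<zeta> + d \<zeta>\<^sup>2\<close>. The number on the left is the \<open>X\<close>-coordinate of the point that is
  the fraction \<open>\<mu>\<close> of the way from \<open>(1 - s) X\<close> to the point of the graph \<open>\<zeta> \<mapsto> g \<zeta> X\<close> over \<open>\<zeta>\<close>; the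
  right-hand side is the radius available over \<open>\<mu> \<zeta>\<close>. With \<open>m = 1 - \<mu>\<close> and \<open>G = g (\<mu> \<zeta>)\<close> the left
  number equals \<open>G - s m v\<close> with \<open>v\<close> close to \<open>1\<close>, hence its square modulus is about
  \<open>|G|\<^sup>2 - 2 s Re m + s\<^sup>2 |m|\<^sup>2\<close>, and \<open>Re m \<ge> |m|\<^sup>2 / 2\<close> since \<open>|\<mu>| \<le> 1\<close>. The error
  \<open>2 s |m| \<omega>\<close> with \<open>\<omega> = O(|\<zeta>|)\<close> can exceed \<open>s |m|\<^sup>2 / 2\<close> only for small \<open>|m|\<close>, where
  \<open>|\<mu>|\<close> is near \<open>1\<close>, and then by at most \<open>2 s \<omega>\<^sup>2 = O(s |\<zeta>|\<^sup>2)\<close>, which the gain in \<open>\<epsilon>\<close> outweighs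
  once \<open>s\<close> is small compared with \<open>\<epsilon>\<close>.
\<close>

lemma centre_near_boundary_estimate:
  fixes c d :: complex
  assumes eps: "\<epsilon> > 0" and rho: "\<rho> > 0"
  obtains s r :: real where "0 < s" "s < 1" "0 < r" "r \<le> \<rho>"
    "\<And>\<zeta> \<mu>. cmod \<zeta> \<le> r \<Longrightarrow> cmod \<mu> \<le> 1 \<Longrightarrow> \<zeta> \<noteq> 0 \<or> \<mu> \<noteq> 1 \<Longrightarrow>
      cmod ((1 - s) + \<mu> * (s + c * \<zeta> + d * \<zeta>^2))
        < cmod (1 + c * (\<mu> * \<zeta>) + d * (\<mu> * \<zeta>)^2) * (1 + \<epsilon> * (cmod (\<mu> * \<zeta>))^2)"
proof -
  define C where "C = cmod c + cmod d + 1"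
  define s where "s = min (1/8) (\<epsilon> / (144 * C^2))"
  \<comment> \<open>The bound \<open>r \<le> s\<close> makes \<open>|\<zeta>|\<^sup>2 / s \<le> |\<zeta>|\<close>, so that the correction in \<open>v\<close> is of first order
    in \<open>|\<zeta>|\<close> uniformly in \<open>s\<close>.\<close>
  define r where "r = Min {\<rho>, s, 1 / (24 * C)}"
  have C: "C \<ge> 1" "cmod c \<le> C" "cmod d \<le> C" "cmod c + cmod d \<le> C" by (auto simp: C_def)
  have s: "0 < s" "s \<le> 1/8" "s \<le> \<epsilon> / (144 * C^2)" using eps C by (auto simp: s_def)
  have r: "0 < r" "r \<le> \<rho>" "r \<le> s" "r \<le> 1 / (24 * C)" using rho s C by (auto simp: r_def)
  have key: "cmod ((1 - s) + \<mu> * (s + c * \<zeta> + d * \<zeta>^2))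
        < cmod (1 + c * (\<mu> * \<zeta>) + d * (\<mu> * \<zeta>)^2) * (1 + \<epsilon> * (cmod (\<mu> * \<zeta>))^2)"
    if lam: "cmod \<zeta> \<le> r" and mu: "cmod \<mu> \<le> 1" and ne: "\<zeta> \<noteq> 0 \<or> \<mu> \<noteq> 1" for \<zeta> \<mu>
  proof -
    define \<kappa> where "\<kappa> = cmod \<zeta>"
    define G where "G = 1 + c * (\<mu> * \<zeta>) + d * (\<mu> * \<zeta>)^2"
    define m where "m = 1 - \<mu>"
    define v where "v = 1 - \<mu> * d * \<zeta>^2 / s"
    define w where "w = v * cnj G"
    define \<omega> where "\<omega> = 3 * C * \<kappa>"
    have k: "0 \<le> \<kappa>" "\<kappa> \<le> r" "\<kappa> \<le> 1" "\<kappa> \<le> s" using lam r s by (auto simp: \<kappa>_def)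
    have Ck: "C * \<kappa> \<le> 1 / 24"
    proof -
      have "C * \<kappa> \<le> C * (1 / (24 * C))" using k r C by (intro mult_left_mono) auto
      also have "\<dots> = 1 / 24" using C by simp
      finally show ?thesis .
    qed
    have k2: "\<kappa>^2 \<le> s * \<kappa>" using k by (simp add: power2_eq_square mult_right_mono)
    have k2': "\<kappa>^2 \<le> \<kappa>" using k by (simp add: power2_eq_square mult_left_le_one_le)
    have om: "0 \<le> \<omega>" "\<omega> \<le> 1/8" using Ck k C by (auto simp: \<omega>_def)
    have G1: "cmod (G - 1) \<le> C * \<kappa>"
    proof -
      have "cmod (G - 1) \<le> cmod (c * (\<mu> * \<zeta>)) + cmod (d * (\<mu> * \<zeta>)^2)"
        by (simp add: G_def norm_triangle_ineq)
      also have "\<dots> = cmod c * (cmod \<mu> * \<kappa>) + cmod d * ((cmod \<mu>)^2 * \<kappa>^2)"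
        by (simp add: norm_mult norm_power \<kappa>_def power_mult_distrib)
      also have "\<dots> \<le> cmod c * (1 * \<kappa>) + cmod d * (1 * \<kappa>)"
        using mu k k2' by (intro add_mono mult_left_mono mult_mono) (auto simp: power_le_one)
      also have "\<dots> = (cmod c + cmod d) * \<kappa>" by (simp add: algebra_simps)
      also have "\<dots> \<le> C * \<kappa>" using C k by (intro mult_right_mono) auto
      finally show ?thesis .
    qed
    have v1: "cmod (v - 1) \<le> C * \<kappa>"
    proof -
      have "cmod (v - 1) = cmod \<mu> * cmod d * \<kappa>^2 / s"
        using s by (simp add: v_def norm_mult norm_divide norm_power \<kappa>_def)
      also have "\<dots> \<le> 1 * C * (s * \<kappa>) / s"
        using mu C k2 s k by (intro divide_right_mono mult_mono) auto
      also have "\<dots> = C * \<kappa>" using s by simp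
      finally show ?thesis .
    qed
    have Gn: "cmod G \<le> 2" "cmod G \<ge> 23/24"
      using G1 Ck norm_triangle_ineq2[of G 1] norm_triangle_ineq2[of 1 G]
      by (auto simp: norm_minus_commute)
    have vn: "cmod v \<le> 2"
      using v1 Ck norm_triangle_ineq2[of v 1] by auto
    have w1: "cmod (w - 1) \<le> \<omega>"
    proof -
      have "w - 1 = (v - 1) * cnj G + cnj (G - 1)" by (simp add: w_def algebra_simps)
      then have "cmod (w - 1) \<le> cmod (v - 1) * cmod G + cmod (G - 1)"
        by (metis complex_mod_cnj norm_mult norm_triangle_ineq)
      also have "\<dots> \<le> (C * \<kappa>) * 2 + C * \<kappa>"
        using v1 Gn G1 k C by (intro add_mono mult_mono) auto
      finally show ?thesis by (simp add: \<omega>_def)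
    qed
    have mRe: "Re m \<ge> (cmod m)^2 / 2"
    proof -
      have "(cmod \<mu>)^2 \<le> 1" using mu by (simp add: power_le_one)
      moreover have "(cmod m)^2 = 1 + (cmod \<mu>)^2 - 2 * Re \<mu>"
        unfolding m_def cmod_power2 by (simp add: power2_eq_square algebra_simps)
      ultimately show ?thesis by (simp add: m_def)
    qed
    have mw: "Re (m * w) \<ge> (cmod m)^2 / 2 - cmod m * \<omega>"
    proof -
      have "Re (m * w) = Re m + Re (m * (w - 1))" by (simp add: algebra_simps)
      moreover have "\<bar>Re (m * (w - 1))\<bar> \<le> cmod m * \<omega>"
        using abs_Re_le_cmod[of "m * (w - 1)"] w1 mult_left_mono[OF w1 norm_ge_zero[of m]]
        by (simp add: norm_mult)
      ultimately show ?thesis using mRe by linarith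
    qed
    have L: "(1 - s) + \<mu> * (s + c * \<zeta> + d * \<zeta>^2) = G - s * (m * v)"
      using s by (simp add: G_def m_def v_def field_simps power2_eq_square)
    have "(cmod (G - s * (m * v)))^2 = (cmod G)^2 - 2 * s * Re (m * w) + s^2 * (cmod m)^2 * (cmod v)^2"
      by (simp only: cmod_power2 w_def) (simp add: power2_eq_square algebra_simps)
    also have "\<dots> \<le> (cmod G)^2 - 2 * s * ((cmod m)^2 / 2 - cmod m * \<omega>) + s^2 * (cmod m)^2 * 2^2"
      using mw s vn by (intro add_mono diff_mono mult_left_mono power_mono) auto
    also have "\<dots> = (cmod G)^2 - s * (cmod m)^2 * (1 - 4 * s) + 2 * s * (cmod m * \<omega>)"
      by (simp add: power2_eq_square algebra_simps)
    also have "\<dots> \<le> (cmod G)^2 - s * (cmod m)^2 * (1 / 2) + 2 * s * (cmod m * \<omega>)"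
      using s by (intro add_mono diff_mono mult_left_mono) auto
    finally have L2: "(cmod (G - s * (m * v)))^2 \<le> (cmod G)^2 + s * (2 * (cmod m * \<omega>) - (cmod m)^2 / 2)"
      by (simp add: algebra_simps)
    have "s * (2 * (cmod m * \<omega>) - (cmod m)^2 / 2) < (cmod G)^2 * (2 * \<epsilon> * (cmod (\<mu> * \<zeta>))^2)"
    proof (cases "\<zeta> = 0 \<or> cmod \<mu> < 1 / 2")
      case True
      have "\<omega> < cmod m / 4"
      proof (cases "\<zeta> = 0")
        case True
        then show ?thesis using ne by (simp add: \<omega>_def \<kappa>_def m_def)
      next
        case False
        then have "cmod m > 1 / 2"
          using True norm_triangle_ineq2[of 1 \<mu>] by (auto simp: m_def)
        then show ?thesis using om by linarith
      qed
      then have "cmod m * \<omega> < cmod m * (cmod m / 4)"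
        using om by (intro mult_strict_left_mono) auto
      then have "2 * (cmod m * \<omega>) - (cmod m)^2 / 2 < 0"
        by (simp add: power2_eq_square)
      then have "s * (2 * (cmod m * \<omega>) - (cmod m)^2 / 2) < 0"
        using s by (simp add: mult_pos_neg)
      also have "0 \<le> (cmod G)^2 * (2 * \<epsilon> * (cmod (\<mu> * \<zeta>))^2)" using eps by simp
      finally show ?thesis .
    next
      case False
      then have kp: "\<kappa> > 0" and mu2: "cmod \<mu> \<ge> 1/2" by (auto simp: \<kappa>_def)
      \<comment> \<open>The maximum over \<open>|m|\<close>, attained at \<open>|m| = 2 \<omega>\<close>.\<close>
      have "2 * (cmod m * \<omega>) - (cmod m)^2 / 2 \<le> 2 * \<omega>^2"
        using zero_le_power2[of "cmod m - 2 * \<omega>"]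
        by (simp add: power2_eq_square algebra_simps)
      then have "s * (2 * (cmod m * \<omega>) - (cmod m)^2 / 2) \<le> s * (2 * \<omega>^2)"
        using s by (intro mult_left_mono) auto
      also have "\<dots> \<le> \<epsilon> / (144 * C^2) * (2 * \<omega>^2)"
        using s by (intro mult_right_mono) auto
      also have "\<dots> = \<epsilon> * \<kappa>^2 / 8"
        using C by (simp add: \<omega>_def power_mult_distrib)
      also have "\<dots> < \<epsilon> * \<kappa>^2 / 4" using eps kp by simp
      also have "\<dots> = (1/2) * (2 * \<epsilon> * ((1/2)^2 * \<kappa>^2))" by (simp add: power2_eq_square)
      also have "\<dots> \<le> (cmod G)^2 * (2 * \<epsilon> * ((cmod \<mu>)^2 * \<kappa>^2))"
      proof (intro mult_mono)
        have "(23/24)^2 \<le> (cmod G)^2" using Gn by (intro power_mono) auto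
        then show "1/2 \<le> (cmod G)^2" by (simp add: power2_eq_square)
        show "(1/2)^2 \<le> (cmod \<mu>)^2" using mu2 by (intro power_mono) auto
      qed (use eps in auto)
      finally show ?thesis by (simp add: norm_mult power_mult_distrib \<kappa>_def)
    qed
    with L2 have "(cmod (G - s * (m * v)))^2 < (cmod G)^2 * (1 + 2 * \<epsilon> * (cmod (\<mu> * \<zeta>))^2)"
      by (simp add: algebra_simps)
    also have "\<dots> \<le> (cmod G)^2 * (1 + \<epsilon> * (cmod (\<mu> * \<zeta>))^2)^2"
      by (intro mult_left_mono) (use eps in \<open>auto simp: power2_eq_square algebra_simps\<close>)
    also have "\<dots> = (cmod G * (1 + \<epsilon> * (cmod (\<mu> * \<zeta>))^2))^2"
      by (simp add: power_mult_distrib)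
    finally have "cmod (G - s * (m * v)) < cmod G * (1 + \<epsilon> * (cmod (\<mu> * \<zeta>))^2)"
      by (rule power2_less_imp_less) (use eps in auto)
    then show ?thesis by (simp only: L G_def[symmetric])
  qed
  show ?thesis
    using that[of s r] s r key by auto
qed

lemma balanced_part_eq:
  "balanced_part D z = {y. \<forall>l. cmod l \<le> 1 \<longrightarrow> z + l *s (y - z) \<in> D}"
  by (force simp: balanced_part_def balanced_indicatrix_def image_iff intro: exI[of _ "_ - z"])

text \<open>
  The logarithm of the radii is a harmonic function plus the strictly subharmonic
  \<open>ln (1 + \<epsilon> |l|\<^sup>2)\<close>, and the ball for \<open>l = 0\<close> has \<open>a + X\<close> on its boundary. Suppose that all
  the balls lie in \<open>D\<close>. The disc \<open>l \<mapsto> a + l b + (1 + c l + d l\<^sup>2) X\<close> then lies in \<open>D\<close> except for its centre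
  \<open>a + X\<close>. Seen from a point \<open>z\<close> of the segment from \<open>a\<close> to \<open>a + X\<close> that is close to the end, it even
  lies in the balanced part of \<open>D\<close> at \<open>z\<close>, together with all its contractions towards \<open>z\<close>, again except for
  the centre. This violates the continuity principle for the balanced part. The point \<open>z\<close> has to be close to
  the boundary: seen from \<open>a\<close> itself, a nonzero \<open>c\<close> would spoil the inclusion.
\<close>

lemma balanced_parts_prevent_touching:
  fixes D :: "(complex ^ 'n) set"
  assumes psc: "\<And>z. z \<in> D \<Longrightarrow> pseudoconvex (balanced_part D z)"
    and "a + X \<notin> D" "X \<noteq> 0" "\<epsilon> > 0" "\<rho> > 0"
  shows "\<exists>l. cmod l \<le> \<rho> \<and>
    \<not> ball (a + l *s b) (norm X * (cmod (1 + c * l + d * l^2) * (1 + \<epsilon> * (cmod l)^2))) \<subseteq> D"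
proof (rule ccontr)
  assume "\<not> ?thesis"
  then have balls: "\<And>l. cmod l \<le> \<rho> \<Longrightarrow>
      ball (a + l *s b) (norm X * (cmod (1 + c * l + d * l^2) * (1 + \<epsilon> * (cmod l)^2))) \<subseteq> D"
    by blast
  obtain s r :: real where s: "0 < s" "s < 1" and r: "0 < r" "r \<le> \<rho>"
    and key: "\<And>l \<mu>. cmod l \<le> r \<Longrightarrow> cmod \<mu> \<le> 1 \<Longrightarrow> l \<noteq> 0 \<or> \<mu> \<noteq> 1 \<Longrightarrow>
      cmod ((1 - s) + \<mu> * (s + c * l + d * l^2))
        < cmod (1 + c * (\<mu> * l) + d * (\<mu> * l)^2) * (1 + \<epsilon> * (cmod (\<mu> * l))^2)"
    using centre_near_boundary_estimate[OF \<open>\<epsilon> > 0\<close> \<open>\<rho> > 0\<close>, of c d] by metis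
  define z where "z = a + (1 - of_real s) *s X"
  define A B C where "A = of_real s *s X" and "B = b + c *s X" and "C = d *s X"
  \<comment> \<open>This is \<open>a + l b + (1 + c l + d l\<^sup>2) X - z\<close>.\<close>
  define P where "P = (\<lambda>l. A + l *s B + l^2 *s C)"
  have mem: "p + w *s X \<in> ball p (norm X * R)" if "cmod w < R" for p w R
    using that \<open>X \<noteq> 0\<close> by (simp add: dist_norm mult.commute)
  have inD: "z + \<mu> *s P l \<in> D" if l: "cmod l \<le> r" and mu: "cmod \<mu> \<le> 1" and ne: "l \<noteq> 0 \<or> \<mu> \<noteq> 1" for \<mu> l
  proof -
    have eq: "z + \<mu> *s P l = (a + (\<mu> * l) *s b) + ((1 - s) + \<mu> * (s + c * l + d * l^2)) *s X"
      by (simp add: z_def P_def A_def B_def C_def vec_eq_iff algebra_simps)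
    have "cmod (\<mu> * l) \<le> 1 * r" unfolding norm_mult using l mu by (intro mult_mono) auto
    then have "cmod (\<mu> * l) \<le> \<rho>" using r by simp
    moreover have "z + \<mu> *s P l \<in> ball (a + (\<mu> * l) *s b)
        (norm X * (cmod (1 + c * (\<mu> * l) + d * (\<mu> * l)^2) * (1 + \<epsilon> * (cmod (\<mu> * l))^2)))"
      unfolding eq by (rule mem[OF key[OF l mu ne]])
    ultimately show ?thesis using balls by blast
  qed
  have "z \<in> D" using inD[of 0 0] r by simp
  have "z + A \<in> balanced_part D z"
  proof (rule pseudoconvex_quadratic_discs[OF psc[OF \<open>z \<in> D\<close>] \<open>r > 0\<close>])
    fix t :: real and l :: complex
    assume t: "0 \<le> t" "t < 1" and l: "cmod l \<le> r"
    have "z + k *s (t *\<^sub>R P l) \<in> D" if k: "cmod k \<le> 1" for k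
    proof -
      have "cmod (k * t) \<le> 1 * t" unfolding norm_mult using k t by (intro mult_mono) auto
      then have "cmod (k * t) < 1" using t by simp
      then have "z + (k * t) *s P l \<in> D" by (intro inD[OF l]) auto
      moreover have "k *s (t *\<^sub>R P l) = (k * t) *s P l"
        by (simp add: vec_eq_iff scaleR_conv_of_real[where 'a = complex] mult_ac)
      ultimately show ?thesis by simp
    qed
    then show "z + t *\<^sub>R (A + l *s B + l\<^sup>2 *s C) \<in> balanced_part D z"
      by (simp add: balanced_part_eq P_def)
  next
    fix l assume "cmod l = r"
    then have "z + k *s P l \<in> D" if "cmod k \<le> 1" for k
      using r that by (intro inD) auto
    then show "z + (A + l *s B + l\<^sup>2 *s C) \<in> balanced_part D z"
      by (simp add: balanced_part_eq P_def)
  qed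
  then have "\<forall>l. cmod l \<le> 1 \<longrightarrow> z + l *s A \<in> D" by (simp add: balanced_part_eq)
  from this[rule_format, of 1] have "z + A \<in> D" by simp
  moreover have "z + A = a + X"
    by (simp add: z_def A_def vec_eq_iff algebra_simps)
  ultimately show False using \<open>a + X \<notin> D\<close> by simp
qed

section \<open>The exhaustion function of the domain\<close>

text \<open>
  If the sub-mean value inequality fails on some disc, there is a point \<open>a'\<close> of it where
  \<open>- ln infdist\<close> is touched from above by a strictly superharmonic function. Exponentiating turns this
  into a lower bound for the distance, that is, into balls inside \<open>D\<close> whose radii grow as
  forbidden by the previous lemma; \<open>X\<close> points from \<open>a'\<close> to a nearest boundary point.
\<close>

lemma psh_neg_ln_boundary_distance:
  fixes D :: "(complex ^ 'n) set"
  assumes "open D" "D \<noteq> UNIV"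
    and psc: "\<And>z. z \<in> D \<Longrightarrow> pseudoconvex (balanced_part D z)"
  shows "continuous_psh_on D (\<lambda>z. - ln (infdist z (- D)))"
  unfolding continuous_psh_on_def
proof (intro conjI allI impI)
  define \<delta> where "\<delta> = (\<lambda>z. infdist z (- D))"
  have cl: "closed (- D)" "- D \<noteq> {}" using assms(1,2) by auto
  have pos: "\<delta> z > 0" if "z \<in> D" for z
    using infdist_pos_not_in_closed[OF cl] that by (simp add: \<delta>_def)
  have balls: "ball z (\<delta> z) \<subseteq> D" for z
    using infdist_le[of _ "- D" z] by (force simp: \<delta>_def)
  have cont: "continuous_on D (\<lambda>z. - ln (\<delta> z))"
    using pos by (force simp: \<delta>_def intro!: continuous_intros)
  then show "continuous_on D (\<lambda>z. - ln (infdist z (- D)))" by (simp add: \<delta>_def)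
  fix a b assume disc: "\<forall>l. norm l \<le> 1 \<longrightarrow> a + l *s b \<in> D"
  define f where "f = (\<lambda>l. - ln (\<delta> (a + l *s b)))"
  have fc: "continuous_on (cball 0 1) f"
    unfolding f_def
    by (rule continuous_on_compose2[OF cont]) (use disc in \<open>auto intro!: continuous_intros\<close>)
  show "- ln (infdist a (- D)) \<le> 1 / (2 * pi) * integral {0..2 * pi} (\<lambda>t. - ln (infdist (a + cis t *s b) (- D)))"
  proof (rule ccontr)
    assume "\<not> ?thesis"
    then have "1 / (2 * pi) * integral {0..2 * pi} (\<lambda>t. f (cis t)) < f 0"
      by (simp add: f_def \<delta>_def)
    then obtain w q \<epsilon> where w: "cmod w < 1" and eps: "\<epsilon> > 0" and q: "poly q 0 = 0"
      and touch: "\<And>z. cmod (w + z) \<le> 1 \<Longrightarrow> f (w + z) \<le> f w + Re (poly q z) - \<epsilon> * (cmod z)^2"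
      using subharmonic_failure_touching[OF fc] by metis
    define a' where "a' = a + w *s b"
    have a': "a' \<in> D" using disc w by (simp add: a'_def)
    obtain y where y: "y \<in> - D" "\<delta> a' = dist a' y"
      using infdist_attains_inf[OF cl] unfolding \<delta>_def by metis
    define X where "X = y - a'"
    have X: "a' + X \<notin> D" "norm X = \<delta> a'" "X \<noteq> 0"
      using y a' by (auto simp: X_def dist_norm norm_minus_commute)
    have q': "poly (- q) 0 = 0" using q by simp
    obtain c d \<rho> where rho: "\<rho> > 0" and
      jet: "\<And>z. cmod z \<le> \<rho> \<Longrightarrow> cmod (1 + c * z + d * z^2) * (1 + \<epsilon> / 2 * (cmod z)^2)
        \<le> cmod (exp (poly (- q) z)) * exp (\<epsilon> * (cmod z)^2)"
      using quadratic_jet_lower_bound[OF q' eps] by metis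
    have "ball (a' + z *s b) (norm X * (cmod (1 + c * z + d * z^2) * (1 + \<epsilon> / 2 * (cmod z)^2))) \<subseteq> D"
      if z: "cmod z \<le> min \<rho> (1 - cmod w)" for z
    proof -
      have wz: "cmod (w + z) \<le> 1" using z norm_triangle_ineq[of w z] by simp
      have eq: "a + (w + z) *s b = a' + z *s b"
        by (simp add: a'_def vec_eq_iff algebra_simps)
      have D: "a' + z *s b \<in> D" using disc wz by (metis eq)
      have "ln (\<delta> a') + (- Re (poly q z) + \<epsilon> * (cmod z)^2) \<le> ln (\<delta> (a' + z *s b))"
        using touch[OF wz] unfolding f_def eq by (simp add: a'_def)
      then have "exp (ln (\<delta> a') + (- Re (poly q z) + \<epsilon> * (cmod z)^2)) \<le> \<delta> (a' + z *s b)"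
        using pos[OF D] by (metis exp_ln exp_le_cancel_iff)
      then have "norm X * (cmod (exp (poly (- q) z)) * exp (\<epsilon> * (cmod z)^2)) \<le> \<delta> (a' + z *s b)"
        using pos[OF a'] by (simp add: exp_add[of "ln (\<delta> a')"] exp_add[of "- Re (poly q z)" "\<epsilon> * (cmod z)^2", symmetric] X(2) norm_exp_eq_Re)
      moreover have "norm X * (cmod (1 + c * z + d * z^2) * (1 + \<epsilon> / 2 * (cmod z)^2))
          \<le> norm X * (cmod (exp (poly (- q) z)) * exp (\<epsilon> * (cmod z)^2))"
        using jet[of z] z by (intro mult_left_mono) auto
      ultimately show ?thesis using balls[of "a' + z *s b"] by (meson order_trans subset_ball)
    qed
    moreover have "\<epsilon> / 2 > 0" "min \<rho> (1 - cmod w) > 0" using eps rho w by auto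
    ultimately show False
      using balanced_parts_prevent_touching[OF psc X(1,3), of "\<epsilon> / 2" "min \<rho> (1 - cmod w)" b c d] by blast
  qed
qed

text \<open>
  By the Cauchy--Schwarz inequality, the real part of a complex-linear functional, normalized at \<open>a\<close>,
  is a minorant. For \<open>a = 0\<close> the division by zero makes this minorant zero.
\<close>

lemma psh_norm: "continuous_psh_on U (norm :: complex ^ 'k \<Rightarrow> real)"
proof (rule continuous_psh_onI)
  fix a b :: "complex ^ 'k"
  let ?f = "\<lambda>t. (norm a)^2 / norm a + (1 / norm a) * (a \<bullet> (cis t ^ 1 *s b))"
  have "(?f has_integral 2 * pi * ((norm a)^2 / norm a) + (1 / norm a) * 0) {0..2*pi}"
    using has_integral_const_real[of "(norm a)^2 / norm a" 0 "2*pi"]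
    by (intro has_integral_add has_integral_mult_right has_integral_smult_cis_power_inner) auto
  moreover have "2 * pi * norm a \<le> 2 * pi * ((norm a)^2 / norm a) + (1 / norm a) * 0"
    by (simp add: power2_eq_square)
  moreover have "?f t \<le> norm (a + cis t *s b)" for t
  proof (cases "a = 0")
    case False
    have "?f t = (a \<bullet> (a + cis t *s b)) / norm a"
      by (simp add: power2_norm_eq_inner inner_add_right add_divide_distrib)
    also have "\<dots> \<le> norm (a + cis t *s b)"
      using False norm_cauchy_schwarz[of a "a + cis t *s b"]
      by (simp add: pos_divide_le_eq mult.commute)
    finally show ?thesis .
  qed simp
  ultimately show "\<exists>f I. (f has_integral I) {0..2*pi} \<and> 2 * pi * norm a \<le> I \<and> (\<forall>t. f t \<le> norm (a + cis t *s b))"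
    by blast
qed (intro continuous_intros)

lemma psh_max:
  assumes u: "continuous_psh_on U u" and v: "continuous_psh_on U v"
  shows "continuous_psh_on U (\<lambda>z. max (u z) (v z))"
proof (rule continuous_psh_onI)
  show "continuous_on U (\<lambda>z. max (u z) (v z))"
    using u v by (intro continuous_intros) (auto simp: continuous_psh_on_def)
next
  fix a b assume disc: "\<And>l. cmod l \<le> 1 \<Longrightarrow> a + l *s b \<in> U"
  have mean: "((\<lambda>t. w (a + cis t *s b)) has_integral integral {0..2*pi} (\<lambda>t. w (a + cis t *s b))) {0..2*pi}
      \<and> 2 * pi * w a \<le> integral {0..2*pi} (\<lambda>t. w (a + cis t *s b))" if w: "continuous_psh_on U w" for w
  proof -
    have "continuous_on U w" using w by (simp add: continuous_psh_on_def)
    then have int: "((\<lambda>t. w (a + cis t *s b)) has_integral integral {0..2*pi} (\<lambda>t. w (a + cis t *s b))) {0..2*pi}"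
      by (rule has_integral_circle[OF _ disc])
    then show ?thesis using psh_le_circle_integral[OF w disc _ int] by auto
  qed
  show "\<exists>f I. (f has_integral I) {0..2*pi} \<and> 2 * pi * max (u a) (v a) \<le> I
      \<and> (\<forall>t. f t \<le> max (u (a + cis t *s b)) (v (a + cis t *s b)))"
  proof (cases "u a \<le> v a")
    case True
    then show ?thesis
      using mean[OF v] by (intro exI[of _ "\<lambda>t. v (a + cis t *s b)"] exI) auto
  next
    case False
    then show ?thesis
      using mean[OF u] by (intro exI[of _ "\<lambda>t. u (a + cis t *s b)"] exI) auto
  qed
qed

text \<open>
  The logarithmic distance controls the approach to the boundary and the norm the approach to
  infinity. Their maximum is used because its sublevel sets are visibly an intersection of a closed set and
  a ball.
\<close>

lemma pseudoconvex_if_balanced_parts: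
  fixes D :: "(complex ^ 'n) set"
  assumes "open D" "D \<noteq> UNIV"
    and psc: "\<And>z. z \<in> D \<Longrightarrow> pseudoconvex (balanced_part D z)"
  shows "pseudoconvex D"
proof -
  let ?u = "\<lambda>z. max (- ln (infdist z (- D))) (norm z)"
  have cl: "closed (- D)" "- D \<noteq> {}" using assms(1,2) by auto
  have "compact {z \<in> D. ?u z \<le> c}" for c
  proof -
    have "{z \<in> D. ?u z \<le> c} = {z. exp (- c) \<le> infdist z (- D)} \<inter> cball 0 c"
    proof (intro equalityI subsetI)
      fix z assume z: "z \<in> {z \<in> D. ?u z \<le> c}"
      then have "infdist z (- D) > 0" using infdist_pos_not_in_closed[OF cl] by simp
      moreover have "- c \<le> ln (infdist z (- D))" using z by simp
      ultimately show "z \<in> {z. exp (- c) \<le> infdist z (- D)} \<inter> cball 0 c"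
        using z by (simp add: ln_ge_iff)
    next
      fix z assume z: "z \<in> {z. exp (- c) \<le> infdist z (- D)} \<inter> cball 0 c"
      then have pos: "infdist z (- D) > 0" by (auto intro: less_le_trans[OF exp_gt_zero])
      then have "z \<in> D" using infdist_zero[of z "- D"] by (metis ComplI less_irrefl)
      moreover have "- c \<le> ln (infdist z (- D))" using z pos by (simp add: ln_ge_iff)
      ultimately show "z \<in> {z \<in> D. ?u z \<le> c}" using z by simp
    qed
    moreover have "closed {z. exp (- c) \<le> infdist z (- D)}"
      by (intro closed_Collect_le continuous_intros)
    ultimately show ?thesis by (simp add: closed_Int_compact)
  qed
  moreover have "continuous_psh_on D ?u"
    by (intro psh_max psh_norm psh_neg_ln_boundary_distance assms)
  ultimately show ?thesis unfolding pseudoconvex_def using \<open>open D\<close> by blast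
qed

section \<open>The indicatrix bundle and its slices\<close>

lemma bounded_componentwise_complex: "bounded {x :: complex ^ 'k. \<forall>i. cmod (x $ i) \<le> B}"
  unfolding bounded_iff
proof (intro exI ballI)
  fix x :: "complex ^ 'k" assume x: "x \<in> {x. \<forall>i. cmod (x $ i) \<le> B}"
  have "norm x \<le> (\<Sum>i\<in>UNIV. cmod (x $ i))"
    unfolding norm_vec_def by (rule L2_set_le_sum) simp
  also have "\<dots> \<le> (\<Sum>i\<in>(UNIV :: 'k set). B)" using x by (intro sum_mono) simp
  finally show "norm x \<le> (\<Sum>i\<in>(UNIV :: 'k set). B)" .
qed

lemma join_coords_mem_image_iff: "join_coords p \<in> join_coords ` S \<longleftrightarrow> p \<in> S"
proof -
  have "p = p'" if "join_coords p = join_coords p'" for p p' :: "(complex ^ 'n) \<times> (complex ^ 'n)"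
  proof -
    have "join_coords p $ i = join_coords p' $ i" for i using that by simp
    from this[of "Inl _"] this[of "Inr _"] show ?thesis
      by (simp add: join_coords_def prod_eq_iff vec_eq_iff)
  qed
  then show ?thesis by blast
qed

text \<open>
  The bundle is cut out by the affine family \<open>(z, w) \<mapsto> z + l w\<close>; the maps for \<open>l = 0\<close> and \<open>l = 1\<close> alone
  make the family proper.
\<close>

lemma pseudoconvex_indicatrix_bundle:
  fixes D :: "(complex ^ 'n) set"
  assumes "pseudoconvex D"
  shows "pseudoconvex (join_coords ` indicatrix_bundle D)"
proof -
  define L where "L = (\<lambda>(l::complex) (x :: complex ^ ('n + 'n)). \<chi> i. x $ Inl i + l * x $ Inr i)"
  have Lj: "L l (join_coords p) = fst p + l *s snd p" for l p
    by (simp add: L_def join_coords_def vec_eq_iff)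
  have surj: "\<exists>p. x = join_coords p" for x :: "complex ^ ('n + 'n)"
    by (rule exI[of _ "(\<chi> i. x $ Inl i, \<chi> i. x $ Inr i)"])
       (simp add: join_coords_def vec_eq_iff split: sum.split)
  have "join_coords ` indicatrix_bundle D = {x. \<forall>l. cmod l \<le> 1 \<longrightarrow> L l x \<in> D}"
  proof (rule set_eqI)
    fix x :: "complex ^ ('n + 'n)"
    obtain p where x: "x = join_coords p" using surj by blast
    have "fst p \<in> D" if "\<forall>l. cmod l \<le> 1 \<longrightarrow> fst p + l *s snd p \<in> D"
      using that[rule_format, of 0] by simp
    then show "x \<in> join_coords ` indicatrix_bundle D \<longleftrightarrow> x \<in> {x. \<forall>l. cmod l \<le> 1 \<longrightarrow> L l x \<in> D}"
      unfolding x join_coords_mem_image_iff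
      by (cases p) (auto simp: Lj indicatrix_bundle_def balanced_indicatrix_def)
  qed
  moreover have "pseudoconvex {x. \<forall>l. cmod l \<le> 1 \<longrightarrow> L l x \<in> D}"
  proof (rule pseudoconvex_affine_family[OF assms, where M = L])
    show "continuous_on UNIV (\<lambda>(x, l). L l x)"
      unfolding L_def split_beta by (intro continuous_intros)
    show "L l (a + c *s b) = L l a + c *s L l b" for l a b c
      by (simp add: L_def vec_eq_iff algebra_simps)
    fix B
    have "cmod (x $ j) \<le> 2 * B" if x: "\<forall>l. cmod l \<le> 1 \<longrightarrow> norm (L l x) \<le> B" for x j
    proof -
      have B: "norm (L 0 x) \<le> B" "norm (L 1 x) \<le> B" using x by auto
      have "B \<ge> 0" using B(1) norm_ge_zero order_trans by blast
      have 0: "cmod (x $ Inl i) \<le> B" for i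
        using Finite_Cartesian_Product.norm_nth_le[of "L 0 x" i] B by (simp add: L_def)
      have 1: "cmod (x $ Inl i + x $ Inr i) \<le> B" for i
        using Finite_Cartesian_Product.norm_nth_le[of "L 1 x" i] B by (simp add: L_def)
      show ?thesis
      proof (cases j)
        case (Inl i)
        then show ?thesis using 0[of i] \<open>B \<ge> 0\<close> by simp
      next
        case (Inr i)
        then show ?thesis using 0[of i] 1[of i] norm_triangle_ineq4[of "x $ Inl i + x $ Inr i" "x $ Inl i"] by simp
      qed
    qed
    then show "bounded {x. \<forall>l. cmod l \<le> 1 \<longrightarrow> norm (L l x) \<le> B}"
      by (intro bounded_subset[OF bounded_componentwise_complex[of "2 * B"]]) auto
  qed
  ultimately show ?thesis by simp
qed

text \<open>
  The balanced part at \<open>z\<close> is the slice of the bundle over \<open>z\<close>, translated by \<open>z\<close>.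
\<close>

lemma pseudoconvex_balanced_part:
  fixes D :: "(complex ^ 'n) set"
  assumes H: "pseudoconvex (join_coords ` indicatrix_bundle D)" and z: "z \<in> D"
  shows "pseudoconvex (balanced_part D z)"
proof -
  define J where "J = (\<lambda>y. join_coords (z, y - z))"
  have "balanced_part D z = {y. \<forall>l. cmod l \<le> 1 \<longrightarrow> J y \<in> join_coords ` indicatrix_bundle D}"
    using z zero_le_one norm_zero
    unfolding J_def join_coords_mem_image_iff balanced_part_eq indicatrix_bundle_def balanced_indicatrix_def
    by (auto dest: spec[of _ 0])
  moreover have "pseudoconvex {y. \<forall>l. cmod l \<le> 1 \<longrightarrow> J y \<in> join_coords ` indicatrix_bundle D}"
  proof (rule pseudoconvex_affine_family[OF H, where L = "\<lambda>_. J" and M = "\<lambda>_ b. join_coords (0, b)"])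
    have "J = (\<lambda>y. \<chi> i. case i of Inl j \<Rightarrow> z $ j | Inr j \<Rightarrow> y $ j - z $ j)"
      by (simp add: J_def join_coords_def fun_eq_iff vec_eq_iff split: sum.split)
    moreover have "continuous_on UNIV (\<lambda>x :: (complex ^ 'n) \<times> complex. case i of Inl j \<Rightarrow> z $ j | Inr j \<Rightarrow> fst x $ j - z $ j)" for i
      by (cases i) (auto intro!: continuous_intros)
    ultimately show "continuous_on UNIV (\<lambda>(y, l::complex). J y)"
      unfolding split_beta by (auto intro!: continuous_on_vec_lambda)
    show "J (a + c *s b) = J a + c *s join_coords (0, b)" for a b c
      by (simp add: J_def join_coords_def vec_eq_iff split: sum.split)
    fix B
    have "cmod (y $ i) \<le> B + norm z" if "\<forall>l::complex. cmod l \<le> 1 \<longrightarrow> norm (J y) \<le> B" for y i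
    proof -
      have y: "norm (J y) \<le> B" using that[rule_format, of 0] by simp
      have "cmod (y $ i - z $ i) \<le> B"
        using Finite_Cartesian_Product.norm_nth_le[of "J y" "Inr i"] y by (simp add: J_def join_coords_def)
      then show ?thesis
        using Finite_Cartesian_Product.norm_nth_le[of z i] norm_triangle_ineq[of "y $ i - z $ i" "z $ i"] by simp
    qed
    then show "bounded {y. \<forall>l::complex. cmod l \<le> 1 \<longrightarrow> norm (J y) \<le> B}"
      by (intro bounded_subset[OF bounded_componentwise_complex[of "B + norm z"]]) blast
  qed
  ultimately show ?thesis by simp
qed

theorem theorem1:
  fixes D :: "(complex ^ 'n) set"
  assumes "open D" and "D \<noteq> UNIV"
  shows "(pseudoconvex D \<longleftrightarrow> pseudoconvex (join_coords ` indicatrix_bundle D)) \<and>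
         (pseudoconvex D \<longleftrightarrow> (\<forall>z\<in>D. pseudoconvex (balanced_part D z)))"
  using pseudoconvex_indicatrix_bundle pseudoconvex_balanced_part
    pseudoconvex_if_balanced_parts[OF assms] by blast

end
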